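(* Let $x$, $y$, $z$, $w$ be four distinct points in some Euclidean space $\mathbb{R}^n$ lying on a circle, and suppose that there are real numbers $\alpha,\beta$ with \[ w = z + \alpha (x-z) + \beta (y-z), \] where $\alpha\neq 1$ and $\beta$ is transcendental over $\mathbb{Q}(\alpha)$. Then the quadrilateral $\{x,y,z,w\}$ does not embed into a transitive set.
   Context: A finite set $T\subset\mathbb{R}^d$ is called transitive if its isometry group (the group of isometries of $\mathbb{R}^d$ mapping $T$ onto itself) acts transitively on $T$. A finite set $X$ embeds into a transitive set if for some $d$ there is a finite transitive set $T\subset\mathbb{R}^d$ containing a subset congruent (isometric) to $X$. *)

theory Defs
  imports "HOL-Analysis.Analysis" "HOL-Algebra.Algebraic_Closure_Type" "HOL-Algebra.Generated_Fields"
begin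

text \<open>
  The dimension of the space containing a transitive set is existentially quantified inside
  the embedding notion below, so it is a natural number \<open>d\<close> rather than an index type.  Points
  of the \<open>d\<close>-dimensional space are the functions \<open>nat \<Rightarrow> real\<close> that vanish from \<open>d\<close> on, that is,
  the elements of \<^term>\<open>topspace (Euclidean_space d)\<close>.
\<close>

definition edist :: "nat \<Rightarrow> (nat \<Rightarrow> real) \<Rightarrow> (nat \<Rightarrow> real) \<Rightarrow> real" where
  "edist d p q = L2_set (\<lambda>i. p i - q i) {..<d}"

definition euclidean_isometry :: "nat \<Rightarrow> ((nat \<Rightarrow> real) \<Rightarrow> (nat \<Rightarrow> real)) \<Rightarrow> bool" where
  "euclidean_isometry d f \<longleftrightarrow>
     bij_betw f (topspace (Euclidean_space d)) (topspace (Euclidean_space d)) \<and>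
     (\<forall>p \<in> topspace (Euclidean_space d). \<forall>q \<in> topspace (Euclidean_space d).
        edist d (f p) (f q) = edist d p q)"

definition transitive_set :: "nat \<Rightarrow> (nat \<Rightarrow> real) set \<Rightarrow> bool" where
  "transitive_set d T \<longleftrightarrow>
     finite T \<and> T \<subseteq> topspace (Euclidean_space d) \<and>
     (\<forall>s \<in> T. \<forall>t \<in> T. \<exists>f. euclidean_isometry d f \<and> f ` T = T \<and> f s = t)"

text \<open>The map \<open>h\<close> is a congruence between \<open>S\<close> and the subset \<open>h ` S\<close> of \<open>T\<close>.\<close>

definition embeds_into_transitive_set :: "'a::metric_space set \<Rightarrow> bool" where
  "embeds_into_transitive_set S \<longleftrightarrow>
     (\<exists>d T h. transitive_set d T \<and> h ` S \<subseteq> T \<and>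
        (\<forall>p \<in> S. \<forall>q \<in> S. edist d (h p) (h q) = dist p q))"

definition is_circle :: "'a::euclidean_space set \<Rightarrow> bool" where
  "is_circle C \<longleftrightarrow>
     (\<exists>P c r. affine P \<and> aff_dim P = 2 \<and> c \<in> P \<and> r > 0 \<and> C = P \<inter> sphere c r)"

abbreviation real_field :: "real ring" where
  "real_field \<equiv> ring_of_type_algebra"

text \<open>
  The subfield generated by \<open>a\<close> contains the unit, hence all rationals, so it is the
  extension of the rationals by \<open>a\<close>.
\<close>

definition transcendental_over_Q_adjoin :: "real \<Rightarrow> real \<Rightarrow> bool" where
  "transcendental_over_Q_adjoin a b \<longleftrightarrow>
     (ring.transcendental real_field over (generate_field real_field {a})) b"

end

theory Submission
  imports Defs
begin

text \<open>
  Since the points are concyclic, the affine relation between them implies the relation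
  \<open>|w - s|\<^sup>2 = \<alpha> |x - s|\<^sup>2 + \<beta> |y - s|\<^sup>2 + \<gamma> |z - s|\<^sup>2\<close> with \<open>\<gamma> = 1 - \<alpha> - \<beta>\<close>, for every point \<open>s\<close> of
  a space containing a copy of the quadrilateral.  If the copy lies in a transitive set \<open>T\<close>, then
  for \<open>f s = |x - s|\<^sup>2\<close> this reads \<open>f \<circ> \<sigma>\<^sub>w = \<alpha> f + \<beta> (f \<circ> \<sigma>\<^sub>y) + \<gamma> (f \<circ> \<sigma>\<^sub>z)\<close> on \<open>T\<close>, where
  the \<open>\<sigma>\<close>'s are permutations of \<open>T\<close>.  Expanding the values of \<open>f\<close> in numbers that are
  linearly independent over \<open>\<rat>(\<alpha>)[\<beta>]\<close> and using that \<open>\<beta>\<close> is transcendental, one gets the same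
  relation with an indeterminate in place of \<open>\<beta>\<close>, for functions on \<open>T\<close> with polynomial values.
  Comparing coefficients and summing over \<open>T\<close> shows that such functions are invariant under
  \<open>\<sigma>\<^sub>y\<close>, hence so is \<open>f\<close>.  But \<open>f\<close> vanishes at \<open>x\<close> and not at the preimage of \<open>x\<close> under the
  isometry moving \<open>x\<close> to \<open>y\<close>.
\<close>

section \<open>Affine combinations and distances\<close>

lemma dist_affine_combination_sq:
  fixes x y z s :: "'a::real_inner"
  assumes "\<alpha> + \<beta> + \<gamma> = 1"
  shows "(dist (\<alpha> *\<^sub>R x + \<beta> *\<^sub>R y + \<gamma> *\<^sub>R z) s)\<^sup>2 =
    \<alpha> * (dist x s)\<^sup>2 + \<beta> * (dist y s)\<^sup>2 + \<gamma> * (dist z s)\<^sup>2 -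
    (\<alpha> * \<beta> * (dist x y)\<^sup>2 + \<alpha> * \<gamma> * (dist x z)\<^sup>2 + \<beta> * \<gamma> * (dist y z)\<^sup>2)"
proof -
  have \<gamma>: "\<gamma> = 1 - \<alpha> - \<beta>" using assms by simp
  show ?thesis
    unfolding \<gamma> dist_norm power2_norm_eq_inner
    by (simp add: inner_simps inner_commute algebra_simps)
qed

lemma edist_sq: "(edist d p q)\<^sup>2 = (\<Sum>i<d. (p i - q i)\<^sup>2)"
  by (simp add: edist_def L2_set_def sum_nonneg)

lemma edist_affine_combination_sq:
  assumes "\<alpha> + \<beta> + \<gamma> = 1"
  shows "(edist d (\<lambda>i. \<alpha> * x i + \<beta> * y i + \<gamma> * z i) s)\<^sup>2 =
    \<alpha> * (edist d x s)\<^sup>2 + \<beta> * (edist d y s)\<^sup>2 + \<gamma> * (edist d z s)\<^sup>2 -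
    (\<alpha> * \<beta> * (edist d x y)\<^sup>2 + \<alpha> * \<gamma> * (edist d x z)\<^sup>2 + \<beta> * \<gamma> * (edist d y z)\<^sup>2)"
proof -
  have \<gamma>: "\<gamma> = 1 - \<alpha> - \<beta>" using assms by simp
  have "(\<alpha> * x i + \<beta> * y i + \<gamma> * z i - s i)\<^sup>2 =
    \<alpha> * (x i - s i)\<^sup>2 + \<beta> * (y i - s i)\<^sup>2 + \<gamma> * (z i - s i)\<^sup>2 -
    (\<alpha> * \<beta> * (x i - y i)\<^sup>2 + \<alpha> * \<gamma> * (x i - z i)\<^sup>2 + \<beta> * \<gamma> * (y i - z i)\<^sup>2)" for i
    unfolding \<gamma> by Groebner_Basis.algebra
  then show ?thesis
    by (simp add: edist_sq sum.distrib sum_subtractf sum_distrib_left)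
qed

text \<open>At the centre \<open>c\<close> all four distances equal \<open>r\<close> and the weights
  sum to 1, so the correction term of the identity vanishes; the second equation is then the case
  \<open>s = w\<close>. Both involve mutual distances only, so they pass to every congruent
  copy.\<close>

lemma concyclic_dist_relations:
  fixes x y z w :: "'a::real_inner"
  assumes "{x, y, z, w} \<subseteq> sphere c r" "w = \<alpha> *\<^sub>R x + \<beta> *\<^sub>R y + \<gamma> *\<^sub>R z" "\<alpha> + \<beta> + \<gamma> = 1"
  shows "\<alpha> * \<beta> * (dist x y)\<^sup>2 + \<alpha> * \<gamma> * (dist x z)\<^sup>2 + \<beta> * \<gamma> * (dist y z)\<^sup>2 = 0"
    and "\<alpha> * (dist x w)\<^sup>2 + \<beta> * (dist y w)\<^sup>2 + \<gamma> * (dist z w)\<^sup>2 = 0"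
proof -
  have "dist x c = r" "dist y c = r" "dist z c = r" "dist w c = r"
    using assms(1) by (auto simp: dist_commute)
  moreover have "\<alpha> * r\<^sup>2 + \<beta> * r\<^sup>2 + \<gamma> * r\<^sup>2 = r\<^sup>2"
    using assms(3) by Groebner_Basis.algebra
  ultimately show *: "\<alpha> * \<beta> * (dist x y)\<^sup>2 + \<alpha> * \<gamma> * (dist x z)\<^sup>2 + \<beta> * \<gamma> * (dist y z)\<^sup>2 = 0"
    using dist_affine_combination_sq[OF assms(3), of x y z c] assms(2) by simp
  show "\<alpha> * (dist x w)\<^sup>2 + \<beta> * (dist y w)\<^sup>2 + \<gamma> * (dist z w)\<^sup>2 = 0"
    using dist_affine_combination_sq[OF assms(3), of x y z w] assms(2) * by simp
qed

text \<open>The affine relation is recovered from distances: the last hypothesis puts the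
  combination \<open>v\<close> at distance 0 from \<open>w\<close>, so the two agree in the first
  \<open>d\<close> coordinates.\<close>

lemma edist_relation:
  assumes "\<alpha> + \<beta> + \<gamma> = 1"
    and 0: "\<alpha> * \<beta> * (edist d x y)\<^sup>2 + \<alpha> * \<gamma> * (edist d x z)\<^sup>2 + \<beta> * \<gamma> * (edist d y z)\<^sup>2 = 0"
    and "\<alpha> * (edist d x w)\<^sup>2 + \<beta> * (edist d y w)\<^sup>2 + \<gamma> * (edist d z w)\<^sup>2 = 0"
  shows "(edist d w s)\<^sup>2 = \<alpha> * (edist d x s)\<^sup>2 + \<beta> * (edist d y s)\<^sup>2 + \<gamma> * (edist d z s)\<^sup>2"
proof -
  define v where "v = (\<lambda>i. \<alpha> * x i + \<beta> * y i + \<gamma> * z i)"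
  have v: "(edist d v s)\<^sup>2 = \<alpha> * (edist d x s)\<^sup>2 + \<beta> * (edist d y s)\<^sup>2 + \<gamma> * (edist d z s)\<^sup>2" for s
    using edist_affine_combination_sq[OF assms(1), of d x y z s] 0 by (simp add: v_def)
  from v[of w] assms(3) have "(\<Sum>i<d. (v i - w i)\<^sup>2) = 0"
    by (simp add: edist_sq)
  then have "v i = w i" if "i < d" for i
    using that by (subst (asm) sum_nonneg_eq_0_iff) auto
  then have "(edist d w s)\<^sup>2 = (edist d v s)\<^sup>2"
    by (simp add: edist_sq)
  with v show ?thesis by simp
qed

section \<open>Coordinates over a subring\<close>

definition coeffs_in :: "'a::comm_ring_1 set \<Rightarrow> 'a poly \<Rightarrow> bool" where
  "coeffs_in K p \<longleftrightarrow> (\<forall>i. poly.coeff p i \<in> K)"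

locale subring_set =
  fixes A :: "'a::idom set"
  assumes one_in: "1 \<in> A"
    and diff_in: "a \<in> A \<Longrightarrow> b \<in> A \<Longrightarrow> a - b \<in> A"
    and mult_in: "a \<in> A \<Longrightarrow> b \<in> A \<Longrightarrow> a * b \<in> A"
begin

lemma zero_in: "0 \<in> A"
  using diff_in[OF one_in one_in] by simp

lemma uminus_in: "a \<in> A \<Longrightarrow> - a \<in> A"
  using diff_in[OF zero_in, of a] by simp

lemma add_in: "a \<in> A \<Longrightarrow> b \<in> A \<Longrightarrow> a + b \<in> A"
  using diff_in[of a "- b"] uminus_in[of b] by simp

lemma sum_in: "(\<And>i. i \<in> I \<Longrightarrow> f i \<in> A) \<Longrightarrow> sum f I \<in> A"
  by (induction I rule: infinite_finite_induct) (auto intro: zero_in add_in)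

lemma coeffs_in_diff: "coeffs_in A p \<Longrightarrow> coeffs_in A q \<Longrightarrow> coeffs_in A (p - q)"
  by (auto simp: coeffs_in_def intro: diff_in)

lemma coeffs_in_add: "coeffs_in A p \<Longrightarrow> coeffs_in A q \<Longrightarrow> coeffs_in A (p + q)"
  by (auto simp: coeffs_in_def intro: add_in)

lemma coeffs_in_mult: "coeffs_in A p \<Longrightarrow> coeffs_in A q \<Longrightarrow> coeffs_in A (p * q)"
  by (auto simp: coeffs_in_def coeff_mult intro!: sum_in mult_in)

lemma coeffs_in_linear: "a \<in> A \<Longrightarrow> b \<in> A \<Longrightarrow> coeffs_in A [:a, b:]"
  by (auto simp: coeffs_in_def coeff_pCons zero_in split: nat.splits)

lemma subring_adjoin: "subring_set ((\<lambda>p. poly p b) ` Collect (coeffs_in A))"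
proof
  have "coeffs_in A [:1:]"
    using coeffs_in_linear[OF one_in zero_in] by simp
  then show "1 \<in> (\<lambda>p. poly p b) ` Collect (coeffs_in A)"
    by (intro image_eqI[of _ _ "[:1:]"]) auto
qed (auto simp flip: poly_diff poly_mult intro!: imageI coeffs_in_diff coeffs_in_mult)

end

text \<open>Meant for finite \<open>B\<close>, since a sum over an infinite set is 0 by
  convention.\<close>

definition independent_over :: "'a::comm_ring_1 set \<Rightarrow> 'a set \<Rightarrow> bool" where
  "independent_over A B \<longleftrightarrow>
     (\<forall>a. (\<forall>b\<in>B. a b \<in> A) \<longrightarrow> (\<Sum>b\<in>B. a b * b) = 0 \<longrightarrow> (\<forall>b\<in>B. a b = 0))"

text \<open>The common denominator \<open>d\<close> spares us the passage to the field of fractions of \<open>A\<close>.\<close>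

lemma (in subring_set) independent_coordinates:
  fixes f :: "'i \<Rightarrow> 'a"
  assumes "finite I"
  obtains d B c where "d \<in> A" "d \<noteq> 0" "finite B" "independent_over A B"
    "\<And>i b. i \<in> I \<Longrightarrow> b \<in> B \<Longrightarrow> c i b \<in> A" "\<And>i. i \<in> I \<Longrightarrow> d * f i = (\<Sum>b\<in>B. c i b * b)"
proof -
  have "\<exists>d B c. d \<in> A \<and> d \<noteq> 0 \<and> finite B \<and> independent_over A B \<and>
    (\<forall>i\<in>I. \<forall>b\<in>B. c i b \<in> A) \<and> (\<forall>i\<in>I. d * f i = (\<Sum>b\<in>B. c i b * b))"
    using assms
  proof (induction I rule: finite_induct)
    case empty
    show ?case
      by (rule exI[of _ 1], rule exI[of _ "{}"]) (auto simp: one_in independent_over_def)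
  next
    case (insert i I)
    then obtain d B c where d: "d \<in> A" "d \<noteq> 0" and B: "finite B" "independent_over A B"
      and c: "\<forall>i\<in>I. \<forall>b\<in>B. c i b \<in> A" and f: "\<forall>i\<in>I. d * f i = (\<Sum>b\<in>B. c i b * b)"
      by blast
    show ?case
    \<comment> \<open>If a nonzero multiple of \<open>f i\<close> lies in the \<open>A\<close>-span
      of \<open>B\<close>, then \<open>B\<close> is kept and the two denominators are multiplied;
      otherwise \<open>f i\<close> itself joins \<open>B\<close>.\<close>
    proof (cases "\<exists>e a. e \<in> A \<and> e \<noteq> 0 \<and> (\<forall>b\<in>B. a b \<in> A) \<and> e * f i = (\<Sum>b\<in>B. a b * b)")
      case True
      then obtain e a where e: "e \<in> A" "e \<noteq> 0" and a: "\<forall>b\<in>B. a b \<in> A"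
        and fi: "e * f i = (\<Sum>b\<in>B. a b * b)" by blast
      define c' where "c' = (\<lambda>j b. if j = i then d * a b else e * c j b)"
      have "(d * e) * f j = (\<Sum>b\<in>B. c' j b * b)" if "j \<in> insert i I" for j
      proof (cases "j = i")
        case True
        have "(d * e) * f i = d * (e * f i)" by (simp add: mult.assoc)
        with True fi show ?thesis
          by (simp add: c'_def sum_distrib_left mult.assoc)
      next
        case False
        have "(d * e) * f j = e * (d * f j)" by (simp add: mult.assoc mult.left_commute)
        with False f that show ?thesis
          by (simp add: c'_def sum_distrib_left mult.assoc)
      qed
      moreover have "\<forall>j\<in>insert i I. \<forall>b\<in>B. c' j b \<in> A"
        using a c d e by (auto simp: c'_def intro: mult_in)
      moreover have "d * e \<in> A" "d * e \<noteq> 0"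
        using d e by (auto intro: mult_in)
      ultimately show ?thesis
        using B by blast
    next
      case False
      then have not_span: "e * f i \<noteq> (\<Sum>b\<in>B. a b * b)"
        if "e \<in> A" "e \<noteq> 0" "\<forall>b\<in>B. a b \<in> A" for e a
        using that by blast
      have notin: "f i \<notin> B"
      proof
        assume "f i \<in> B"
        then have "1 * f i = (\<Sum>b\<in>B. (if b = f i then 1 else 0) * b)"
          using B(1) by (simp add: if_distrib[of "\<lambda>u. u * _"] cong: if_cong)
        moreover have "\<forall>b\<in>B. (if b = f i then 1 else 0) \<in> A"
          using one_in zero_in by simp
        ultimately show False
          using not_span[of 1 "\<lambda>b. if b = f i then 1 else 0"] one_in by simp
      qed
      \<comment> \<open>In a vanishing combination, a nonzero coefficient at \<open>f i\<close>
        would be a denominator putting \<open>f i\<close> in the span of \<open>B\<close>.\<close>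
      have "independent_over A (insert (f i) B)"
        unfolding independent_over_def
      proof (intro allI impI)
        fix a assume a: "\<forall>b\<in>insert (f i) B. a b \<in> A"
          and "(\<Sum>b\<in>insert (f i) B. a b * b) = 0"
        then have sum: "a (f i) * f i + (\<Sum>b\<in>B. a b * b) = 0"
          using B(1) notin by simp
        then have "a (f i) * f i = (\<Sum>b\<in>B. - a b * b)"
          by (simp add: sum_negf eq_neg_iff_add_eq_0)
        moreover have "\<forall>b\<in>B. - a b \<in> A" using a uminus_in by simp
        ultimately have "a (f i) = 0"
          using not_span[of "a (f i)" "\<lambda>b. - a b"] a by auto
        with sum B(2) a show "\<forall>b\<in>insert (f i) B. a b = 0"
          by (simp add: independent_over_def)
      qed
      moreover define c' where
        "c' = (\<lambda>j b. if j = i then if b = f i then d else 0 else if b = f i then 0 else c j b)"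
      have "d * f j = (\<Sum>b\<in>insert (f i) B. c' j b * b)" if "j \<in> insert i I" for j
      proof (cases "j = i")
        case True
        have "(\<Sum>b\<in>B. c' j b * b) = 0"
          using notin True by (intro sum.neutral) (auto simp: c'_def)
        with True B(1) notin show ?thesis by (simp add: c'_def)
      next
        case False
        have "(\<Sum>b\<in>B. c' j b * b) = (\<Sum>b\<in>B. c j b * b)"
          using notin False by (intro sum.cong) (auto simp: c'_def)
        with False B(1) notin f that show ?thesis by (simp add: c'_def)
      qed
      moreover have "\<forall>j\<in>insert i I. \<forall>b\<in>insert (f i) B. c' j b \<in> A"
        using c d zero_in by (auto simp: c'_def)
      ultimately show ?thesis
        using d B(1) by (intro exI[of _ d] exI[of _ "insert (f i) B"] exI[of _ c']) auto
    qed
  qed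
  then show ?thesis using that by blast
qed

section \<open>Functions satisfying a linear relation between their permutations\<close>

text \<open>Equality case of Cauchy-Schwarz: \<open>a\<close> and its permuted copy have the same
  norm.\<close>

lemma sum_sq_diff_eq_0D:
  fixes a :: "'a \<Rightarrow> real"
  assumes "finite T" "bij_betw \<sigma> T T" "(\<Sum>s\<in>T. a s * a (\<sigma> s)) = (\<Sum>s\<in>T. (a s)\<^sup>2)" "s \<in> T"
  shows "a (\<sigma> s) = a s"
proof -
  have "(\<Sum>s\<in>T. (a (\<sigma> s))\<^sup>2) = (\<Sum>s\<in>T. (a s)\<^sup>2)"
    by (rule sum.reindex_bij_betw[OF assms(2)])
  moreover have "(\<Sum>s\<in>T. (a (\<sigma> s) - a s)\<^sup>2) =
      (\<Sum>s\<in>T. (a (\<sigma> s))\<^sup>2) + (\<Sum>s\<in>T. (a s)\<^sup>2) - 2 * (\<Sum>s\<in>T. a s * a (\<sigma> s))"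
    by (simp add: power2_diff sum.distrib sum_subtractf sum_distrib_left mult_ac)
  ultimately have "(\<Sum>s\<in>T. (a (\<sigma> s) - a s)\<^sup>2) = 0"
    using assms(3) by simp
  with assms(1,4) show ?thesis
    by (subst (asm) sum_nonneg_eq_0_iff) auto
qed

text \<open>Here \<open>a\<close> and \<open>b\<close> stand for consecutive coefficients,
  \<open>a\<close> being the lowest one not yet known to be invariant. Each invariance comes from a
  sum over \<open>T\<close> to which the equality case above applies.\<close>

lemma invariant_of_consecutive_coeffs:
  fixes a b :: "'a \<Rightarrow> real"
  assumes T: "finite T" "bij_betw \<sigma>y T T" "bij_betw \<sigma>z T T" "bij_betw \<sigma>w T T"
    and \<alpha>: "\<alpha> \<noteq> 0" "\<alpha> \<noteq> 1"
    and a: "\<And>s. s \<in> T \<Longrightarrow> a (\<sigma>w s) = \<alpha> * a s + (1 - \<alpha>) * a (\<sigma>z s)"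
    and b: "\<And>s. s \<in> T \<Longrightarrow>
      b (\<sigma>w s) = \<alpha> * b s + (1 - \<alpha>) * b (\<sigma>z s) + a (\<sigma>y s) - a (\<sigma>z s)"
    and s: "s \<in> T"
  shows "a (\<sigma>y s) = a s" "a (\<sigma>z s) = a s"
proof -
  have reindex: "(\<Sum>s\<in>T. g (\<sigma>z s)) = sum g T" "(\<Sum>s\<in>T. g (\<sigma>w s)) = sum g T"
    for g :: "'a \<Rightarrow> real"
    using sum.reindex_bij_betw[OF T(3)] sum.reindex_bij_betw[OF T(4)] by auto
  let ?S = "\<Sum>s\<in>T. (a s)\<^sup>2"
  \<comment> \<open>Squaring the relation for \<open>a\<close> and summing isolates the correlation
    of \<open>a\<close> with its \<open>\<sigma>z\<close>-copy, with factor 2\<alpha>(1 - \<alpha>),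
    which is nonzero.\<close>
  have "?S = (\<Sum>s\<in>T. (\<alpha> * a s + (1 - \<alpha>) * a (\<sigma>z s))\<^sup>2)"
    using reindex(2)[of "\<lambda>s. (a s)\<^sup>2"] a by simp
  also have "\<dots> = (\<Sum>s\<in>T. \<alpha>\<^sup>2 * (a s)\<^sup>2 + (1 - \<alpha>)\<^sup>2 * (a (\<sigma>z s))\<^sup>2
      + 2 * \<alpha> * (1 - \<alpha>) * (a s * a (\<sigma>z s)))"
    by (intro sum.cong refl) Groebner_Basis.algebra
  also have "\<dots> = \<alpha>\<^sup>2 * ?S + (1 - \<alpha>)\<^sup>2 * ?S
      + 2 * \<alpha> * (1 - \<alpha>) * (\<Sum>s\<in>T. a s * a (\<sigma>z s))"
    using reindex(1)[of "\<lambda>s. (a s)\<^sup>2"] by (simp add: sum.distrib flip: sum_distrib_left)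
  finally have "2 * \<alpha> * (1 - \<alpha>) * ((\<Sum>s\<in>T. a s * a (\<sigma>z s)) - ?S) = 0"
    by Groebner_Basis.algebra
  with \<alpha> have "(\<Sum>s\<in>T. a s * a (\<sigma>z s)) = ?S" by simp
  from sum_sq_diff_eq_0D[OF T(1,3) this]
  have z: "a (\<sigma>z s) = a s" if "s \<in> T" for s using that .
  have w: "a (\<sigma>w s) = a s" if "s \<in> T" for s
    using a[OF that] z[OF that] by (simp add: algebra_simps)
  \<comment> \<open>The relation for \<open>b\<close> times \<open>a s\<close>. Invariance of
    \<open>a\<close> lets each value of \<open>b\<close> be paired with \<open>a\<close> at the same
    point, so after reindexing the \<open>b\<close> terms cancel, as 1 = \<alpha> + (1 -
    \<alpha>).\<close>
  have "a s * a (\<sigma>y s) = (a s)\<^sup>2 + a (\<sigma>w s) * b (\<sigma>w s) - \<alpha> * (a s * b s)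
      - (1 - \<alpha>) * (a (\<sigma>z s) * b (\<sigma>z s))" if "s \<in> T" for s
    using b[OF that] z[OF that] w[OF that] by Groebner_Basis.algebra
  then have "(\<Sum>s\<in>T. a s * a (\<sigma>y s)) = ?S + (\<Sum>s\<in>T. a (\<sigma>w s) * b (\<sigma>w s))
      - \<alpha> * (\<Sum>s\<in>T. a s * b s) - (1 - \<alpha>) * (\<Sum>s\<in>T. a (\<sigma>z s) * b (\<sigma>z s))"
    by (simp add: sum.distrib sum_subtractf flip: sum_distrib_left)
  then have "(\<Sum>s\<in>T. a s * a (\<sigma>y s)) = ?S"
    using reindex[of "\<lambda>s. a s * b s"] by (simp add: algebra_simps)
  from sum_sq_diff_eq_0D[OF T(1,2) this s] show "a (\<sigma>y s) = a s" .
  from z[OF s] show "a (\<sigma>z s) = a s" .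
qed

text \<open>Induction on the degree: invariance of the coefficients of degree \<open>k\<close>
  removes the inhomogeneous term in degree \<open>k + 1\<close>, whose coefficients then satisfy the
  relation required of \<open>a\<close>.\<close>

lemma invariant_of_poly_relation:
  fixes p :: "'a \<Rightarrow> real poly"
  assumes T: "finite T" "bij_betw \<sigma>y T T" "bij_betw \<sigma>z T T" "bij_betw \<sigma>w T T"
    and \<alpha>: "\<alpha> \<noteq> 0" "\<alpha> \<noteq> 1"
    and p: "\<And>s. s \<in> T \<Longrightarrow>
      p (\<sigma>w s) = [:\<alpha>:] * p s + [:0, 1:] * p (\<sigma>y s) + [:1 - \<alpha>, -1:] * p (\<sigma>z s)"
    and s: "s \<in> T"
  shows "p (\<sigma>y s) = p s"
proof -
  have rel0: "poly.coeff (p (\<sigma>w s)) 0 = \<alpha> * poly.coeff (p s) 0 + (1 - \<alpha>) * poly.coeff (p (\<sigma>z s)) 0"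
    if "s \<in> T" for s
    using p[OF that] by simp
  have rel: "poly.coeff (p (\<sigma>w s)) (Suc k) =
      \<alpha> * poly.coeff (p s) (Suc k) + (1 - \<alpha>) * poly.coeff (p (\<sigma>z s)) (Suc k)
      + poly.coeff (p (\<sigma>y s)) k - poly.coeff (p (\<sigma>z s)) k" if "s \<in> T" for s k
    using p[OF that] by simp
  have "\<forall>s\<in>T. poly.coeff (p (\<sigma>y s)) k = poly.coeff (p s) k \<and>
      poly.coeff (p (\<sigma>z s)) k = poly.coeff (p s) k" for k
  proof (induction k)
    case 0
    show ?case
      using invariant_of_consecutive_coeffs[OF T \<alpha>, of "\<lambda>s. poly.coeff (p s) 0"
          "\<lambda>s. poly.coeff (p s) (Suc 0)"] rel0 rel by blast
  next
    case (Suc k)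
    then have "poly.coeff (p (\<sigma>w s)) (Suc k) =
      \<alpha> * poly.coeff (p s) (Suc k) + (1 - \<alpha>) * poly.coeff (p (\<sigma>z s)) (Suc k)" if "s \<in> T" for s
      using rel[OF that] that by simp
    then show ?case
      using invariant_of_consecutive_coeffs[OF T \<alpha>, of "\<lambda>s. poly.coeff (p s) (Suc k)"
          "\<lambda>s. poly.coeff (p s) (Suc (Suc k))"] rel by blast
  qed
  with s show ?thesis by (simp add: poly_eq_iff)
qed

lemma invariant_of_transcendental_relation:
  fixes f :: "'a \<Rightarrow> real"
  assumes T: "finite T" "bij_betw \<sigma>y T T" "bij_betw \<sigma>z T T" "bij_betw \<sigma>w T T"
    and \<alpha>: "\<alpha> \<noteq> 0" "\<alpha> \<noteq> 1"
    and K: "subring_set K" "\<alpha> \<in> K"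
    and \<beta>: "\<And>p. coeffs_in K p \<Longrightarrow> poly p \<beta> = 0 \<Longrightarrow> p = 0"
    and f: "\<And>s. s \<in> T \<Longrightarrow> f (\<sigma>w s) = \<alpha> * f s + \<beta> * f (\<sigma>y s) + (1 - \<alpha> - \<beta>) * f (\<sigma>z s)"
    and s: "s \<in> T"
  shows "f (\<sigma>y s) = f s"
proof -
  interpret K: subring_set K by (rule K(1))
  define A where "A = (\<lambda>p. poly p \<beta>) ` Collect (coeffs_in K)"
  interpret A: subring_set A
    unfolding A_def by (rule K.subring_adjoin)
  obtain d B c where "d \<in> A" and d: "d \<noteq> 0" and "finite B" and B: "independent_over A B"
    and c: "\<And>s b. s \<in> T \<Longrightarrow> b \<in> B \<Longrightarrow> c s b \<in> A"
    and df: "\<And>s. s \<in> T \<Longrightarrow> d * f s = (\<Sum>b\<in>B. c s b * b)"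
    using A.independent_coordinates[OF T(1), of f] by blast
  have maps: "\<sigma>y s \<in> T" "\<sigma>z s \<in> T" "\<sigma>w s \<in> T" if "s \<in> T" for s
    using T that by (auto dest: bij_betwE)
  have "\<exists>q. coeffs_in K q \<and> poly q \<beta> = c s b" if "s \<in> T" "b \<in> B" for s b
    using c[OF that] by (auto simp: A_def)
  then obtain q where q: "\<And>s b. s \<in> T \<Longrightarrow> b \<in> B \<Longrightarrow> coeffs_in K (q s b)"
    "\<And>s b. s \<in> T \<Longrightarrow> b \<in> B \<Longrightarrow> poly (q s b) \<beta> = c s b"
    by metis
  \<comment> \<open>The defect of the polynomial relation in coordinate \<open>b\<close>. Its value
    at \<beta> vanishes by independence of \<open>B\<close>, hence \<open>r s b\<close> itself
    vanishes by transcendence.\<close>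
  define r where "r s b = q (\<sigma>w s) b -
    ([:\<alpha>:] * q s b + [:0, 1:] * q (\<sigma>y s) b + [:1 - \<alpha>, -1:] * q (\<sigma>z s) b)" for s b
  have r: "coeffs_in K (r s b)" if "s \<in> T" "b \<in> B" for s b
    using that q(1) maps K(2) K.coeffs_in_linear[of \<alpha> 0] K.zero_in K.one_in
    unfolding r_def
    by (intro K.coeffs_in_diff K.coeffs_in_add K.coeffs_in_mult K.coeffs_in_linear)
      (auto intro: K.diff_in K.uminus_in)
  have "r s b = 0" if "s \<in> T" "b \<in> B" for s b
  proof -
    have "(\<Sum>b\<in>B. poly (r s b) \<beta> * b) = (\<Sum>b\<in>B. c (\<sigma>w s) b * b - \<alpha> * (c s b * b)
        - \<beta> * (c (\<sigma>y s) b * b) - (1 - \<alpha> - \<beta>) * (c (\<sigma>z s) b * b))"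
      using \<open>s \<in> T\<close> maps q(2) by (intro sum.cong refl) (simp add: r_def algebra_simps)
    also have "\<dots> = d * f (\<sigma>w s) - \<alpha> * (d * f s) - \<beta> * (d * f (\<sigma>y s))
        - (1 - \<alpha> - \<beta>) * (d * f (\<sigma>z s))"
      using \<open>s \<in> T\<close> maps by (simp add: df sum_subtractf flip: sum_distrib_left)
    also have "\<dots> = 0"
      using f[OF \<open>s \<in> T\<close>] by Groebner_Basis.algebra
    finally have "(\<Sum>b\<in>B. poly (r s b) \<beta> * b) = 0" .
    moreover have "\<forall>b\<in>B. poly (r s b) \<beta> \<in> A"
      using r[OF \<open>s \<in> T\<close>] by (simp add: A_def)
    ultimately have "poly (r s b) \<beta> = 0"
      using B[unfolded independent_over_def, THEN spec[of _ "\<lambda>b. poly (r s b) \<beta>"]] that(2)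
      by blast
    with \<beta> r that show ?thesis by blast
  qed
  then have "q (\<sigma>y s) b = q s b" if "b \<in> B" for b
    using that s by (intro invariant_of_poly_relation[OF T \<alpha>, of "\<lambda>s. q s b"]) (auto simp: r_def)
  then have "c (\<sigma>y s) b = c s b" if "b \<in> B" for b
    using that s maps q(2) by metis
  then have "d * f (\<sigma>y s) = d * f s"
    using s maps by (simp add: df)
  with d show ?thesis by simp
qed

section \<open>The extension of the rationals by a real number\<close>

lemma subring_set_generate_field:
  fixes H :: "real set"
  shows "subring_set (generate_field real_field H)"
proof -
  interpret field "real_field :: real ring"
    by (rule field_from_type_algebra)
  have "subring (generate_field real_field H) (real_field :: real ring)"
    by (intro subfieldE(1) generate_field_is_subfield) (simp add: ring_of_type_algebra_def)
  note * = subringE[OF this]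
  have "\<ominus>\<^bsub>real_field\<^esub> b = - b" for b :: real
    by (rule minus_equality) (auto simp: ring_of_type_algebra_def)
  then show ?thesis
    using *(3,5,6) *(7)[of _ "\<ominus>\<^bsub>real_field\<^esub> _"]
    by unfold_locales (auto simp: ring_of_type_algebra_def)
qed

text \<open>The list representation puts the leading coefficient first, whereas \<open>Poly\<close>
  expects the constant term first; hence \<open>rev\<close>.\<close>

lemma eval_real_field:
  "ring.eval (real_field :: real ring) xs x = poly (Poly (rev xs)) x"
proof -
  interpret field "real_field :: real ring"
    by (rule field_from_type_algebra)
  have pow: "x [^]\<^bsub>real_field\<^esub> n = x ^ n" for n :: nat
    by (induction n) (auto simp: ring_of_type_algebra_def)
  show ?thesis
    by (induction xs) (simp_all add: pow, simp_all add: ring_of_type_algebra_def Poly_append poly_monom)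
qed

lemma transcendental_over_Q_adjoinD:
  assumes "transcendental_over_Q_adjoin a b"
    and p: "coeffs_in (generate_field real_field {a}) p" "poly p b = 0"
  shows "p = 0"
proof -
  interpret field "real_field :: real ring"
    by (rule field_from_type_algebra)
  let ?xs = "rev (coeffs p)"
  have "set ?xs \<subseteq> generate_field real_field {a}"
    using p(1) by (auto simp: coeffs_in_def coeffs_def)
  moreover have "?xs = [] \<or> hd ?xs \<noteq> 0"
    by (auto simp: hd_rev last_coeffs_eq_coeff_degree)
  ultimately have "?xs \<in> carrier ((generate_field real_field {a})[X]\<^bsub>real_field\<^esub>)"
    by (auto simp: univ_poly_def polynomial_def ring_of_type_algebra_def)
  moreover have "ring.eval real_field ?xs b = \<zero>\<^bsub>real_field\<^esub>"
    using p(2) by (simp add: eval_real_field) (simp add: ring_of_type_algebra_def)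
  ultimately have "?xs = []"
    using eval_transcendental assms(1) unfolding transcendental_over_Q_adjoin_def by blast
  then show ?thesis by simp
qed

section \<open>Transitive sets\<close>

text \<open>Take for \<open>\<sigma>\<close> the inverse on \<open>T\<close> of an isometry moving
  \<open>x\<close> to \<open>y\<close>.\<close>

lemma transitive_set_permutation:
  assumes T: "transitive_set d T" and x: "x \<in> T" and y: "y \<in> T"
  obtains \<sigma> where "bij_betw \<sigma> T T" "\<And>s. s \<in> T \<Longrightarrow> edist d y s = edist d x (\<sigma> s)"
proof -
  from assms obtain f where f: "euclidean_isometry d f" "f ` T = T" "f x = y"
    unfolding transitive_set_def by blast
  have T': "T \<subseteq> topspace (Euclidean_space d)"
    using T by (simp add: transitive_set_def)
  with f have "bij_betw f T T"
    unfolding euclidean_isometry_def bij_betw_def by (blast intro: inj_on_subset)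
  then have \<sigma>: "bij_betw (inv_into T f) T T"
    by (rule bij_betw_inv_into)
  have "edist d y s = edist d x (inv_into T f s)" if "s \<in> T" for s
  proof -
    have "inv_into T f s \<in> T" "f (inv_into T f s) = s"
      using that f(2) by (simp_all add: inv_into_into f_inv_into_f)
    then show ?thesis
      using f T' x unfolding euclidean_isometry_def by (metis subsetD)
  qed
  with \<sigma> that show ?thesis by blast
qed

theorem theorem1:
  fixes x y z w :: "real ^ 'n" and \<alpha> \<beta> :: real
  assumes "distinct [x, y, z, w]"
    and "\<exists>C. is_circle C \<and> {x, y, z, w} \<subseteq> C"
    and "w = z + \<alpha> *\<^sub>R (x - z) + \<beta> *\<^sub>R (y - z)"
    and "\<alpha> \<noteq> 1"
    and "transcendental_over_Q_adjoin \<alpha> \<beta>"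
  shows "\<not> embeds_into_transitive_set {x, y, z, w}"
proof
  define \<gamma> where "\<gamma> = 1 - \<alpha> - \<beta>"
  have sum1: "\<alpha> + \<beta> + \<gamma> = 1" by (simp add: \<gamma>_def)
  have w: "w = \<alpha> *\<^sub>R x + \<beta> *\<^sub>R y + \<gamma> *\<^sub>R z"
    using assms(3) by (simp add: \<gamma>_def algebra_simps)
  obtain c r where "{x, y, z, w} \<subseteq> sphere c r"
    using assms(2) by (auto simp: is_circle_def)
  note rel = concyclic_dist_relations[OF this w sum1]
  \<comment> \<open>For \<alpha> = 0 the first distance relation becomes \<beta>\<gamma>|y - z|^2 =
    0, which forces \<open>w = z\<close> or \<open>w = y\<close>.\<close>
  have \<alpha>0: "\<alpha> \<noteq> 0"
  proof
    assume "\<alpha> = 0"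
    with rel(1) assms(1) have "\<beta> = 0 \<or> \<gamma> = 0" by auto
    with \<open>\<alpha> = 0\<close> sum1 w assms(1) show False by auto
  qed
  assume "embeds_into_transitive_set {x, y, z, w}"
  then obtain d T h where T: "transitive_set d T" "h ` {x, y, z, w} \<subseteq> T"
    and h: "\<And>p q. p \<in> {x, y, z, w} \<Longrightarrow> q \<in> {x, y, z, w} \<Longrightarrow> edist d (h p) (h q) = dist p q"
    unfolding embeds_into_transitive_set_def by blast
  then have hT: "h x \<in> T" "h y \<in> T" "h z \<in> T" "h w \<in> T" by auto
  obtain \<sigma>y where y: "bij_betw \<sigma>y T T" "\<And>s. s \<in> T \<Longrightarrow> edist d (h y) s = edist d (h x) (\<sigma>y s)"
    using transitive_set_permutation[OF T(1) hT(1,2)] by blast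
  obtain \<sigma>z where z: "bij_betw \<sigma>z T T" "\<And>s. s \<in> T \<Longrightarrow> edist d (h z) s = edist d (h x) (\<sigma>z s)"
    using transitive_set_permutation[OF T(1) hT(1,3)] by blast
  obtain \<sigma>w where w: "bij_betw \<sigma>w T T" "\<And>s. s \<in> T \<Longrightarrow> edist d (h w) s = edist d (h x) (\<sigma>w s)"
    using transitive_set_permutation[OF T(1) hT(1,4)] by blast
  define f where "f s = (edist d (h x) s)\<^sup>2" for s
  have f: "f (\<sigma>w s) = \<alpha> * f s + \<beta> * f (\<sigma>y s) + (1 - \<alpha> - \<beta>) * f (\<sigma>z s)" if "s \<in> T" for s
    using edist_relation[OF sum1, of d "h x" "h y" "h z" "h w" s] rel that
    by (simp add: h f_def \<gamma>_def flip: y(2) z(2) w(2))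
  have "f (\<sigma>y (h x)) = f (h x)"
  proof (rule invariant_of_transcendental_relation[where f = f and \<sigma>y = \<sigma>y and \<sigma>z = \<sigma>z and \<sigma>w = \<sigma>w
        and \<alpha> = \<alpha> and \<beta> = \<beta> and T = T and K = "generate_field real_field {\<alpha>}"])
    show "finite T" using T(1) by (simp add: transitive_set_def)
    show "\<alpha> \<in> generate_field real_field {\<alpha>}" by (rule generate_field.incl) simp
  qed (fact y(1) z(1) w(1) \<alpha>0 assms(4) hT(1) subring_set_generate_field f
      transcendental_over_Q_adjoinD[OF assms(5)])+
  \<comment> \<open>By the choice of \<open>\<sigma>y\<close>, the value of \<open>f\<close> at
    \<open>\<sigma>y (h x)\<close> is the squared distance from \<open>h y\<close> to
    \<open>h x\<close>.\<close>
  then have "(dist y x)\<^sup>2 = (dist x x)\<^sup>2"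
    using hT(1) by (simp add: f_def h flip: y(2))
  with assms(1) show False by simp
qed

end
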